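(* Let $k\in\{1,\dots,K\}$, and let the MUE transmit power $P_0\in[0,P_T]$ and the transmit powers $\boldsymbol p_{-k}=(P_{k'})_{k'\neq k}\in[0,P_T]^{K-1}$ of the other SUEs be given. Then the optimization problem $$\max_{P_k}\ U_k(P_k,\boldsymbol p_{-k},P_0)\quad\text{s.t.}\quad 0\le P_k\le P_T$$ has a globally optimal solution, given by $$\tilde P_k^*=\begin{cases}P_T, & P_k^{\rm tmp}>P_T,\\ P_k^{\rm tmp}, & 0<P_k^{\rm tmp}\le P_T,\\ 0, & P_k^{\rm tmp}\le 0,\end{cases}$$ or equivalently $\tilde P_k^*=P_T-\left[P_T-(P_k^{\rm tmp})^+\right]^+$, where $(x)^+=\max(x,0)$ and $$P_k^{\rm tmp}=\frac1{\lambda_k}-\frac{N_0+H_{k0}P_0+\sum_{k'\ne k,\,k'=1}^K H_{kk'}P_{k'}}{H_{kk}}.$$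
   Context: A network has one macrocell user equipment (MUE, index $0$) and $K\ge 1$ small-cell user equipments (SUEs, indices $1,\dots,K$). The data are real numbers: channel gains $H_{ij}>0$ ($0\le i,j\le K$), where $H_{ij}$ is the gain from user $j$ to the base station of user $i$; noise power $N_0>0$; maximum transmit power $P_T>0$; cost coefficients $\lambda_0,\lambda_1,\dots,\lambda_K>0$. $P_0$ is the transmit power of the MUE and $P_k$ that of the $k$th SUE. The utility of the $k$th SUE is $$U_k(P_k,\boldsymbol p_{-k},P_0)=\ln\left(1+\frac{H_{kk}P_k}{N_0+H_{k0}P_0+\sum_{k'\ne k,\,k'=1}^K H_{kk'}P_{k'}}\right)-\lambda_kP_k .$$ *)

theory Defs
  imports Complex_Main
begin

(* Users are indexed by 0..K, with 0 the MUE; H i j is the gain from user j to the base station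
   of user i.  The vector p_{-k} is a function p :: nat => real that is only ever evaluated on
   {1..K} - {k}, so its value at k is irrelevant. *)

definition interference_noise ::
  "nat \<Rightarrow> (nat \<Rightarrow> nat \<Rightarrow> real) \<Rightarrow> real \<Rightarrow> nat \<Rightarrow> (nat \<Rightarrow> real) \<Rightarrow> real \<Rightarrow> real" where
  "interference_noise K H N0 k p P0 =
     N0 + H k 0 * P0 + (\<Sum>k'\<in>{1..K} - {k}. H k k' * p k')"

definition utility ::
  "nat \<Rightarrow> (nat \<Rightarrow> nat \<Rightarrow> real) \<Rightarrow> real \<Rightarrow> (nat \<Rightarrow> real) \<Rightarrow> nat \<Rightarrow> real \<Rightarrow> (nat \<Rightarrow> real) \<Rightarrow> real \<Rightarrow> real" where
  "utility K H N0 lam k Pk p P0 =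
     ln (1 + H k k * Pk / interference_noise K H N0 k p P0) - lam k * Pk"

definition P_tmp ::
  "nat \<Rightarrow> (nat \<Rightarrow> nat \<Rightarrow> real) \<Rightarrow> real \<Rightarrow> (nat \<Rightarrow> real) \<Rightarrow> nat \<Rightarrow> (nat \<Rightarrow> real) \<Rightarrow> real \<Rightarrow> real" where
  "P_tmp K H N0 lam k p P0 = 1 / lam k - interference_noise K H N0 k p P0 / H k k"

definition P_opt ::
  "nat \<Rightarrow> (nat \<Rightarrow> nat \<Rightarrow> real) \<Rightarrow> real \<Rightarrow> real \<Rightarrow> (nat \<Rightarrow> real) \<Rightarrow> nat \<Rightarrow> (nat \<Rightarrow> real) \<Rightarrow> real \<Rightarrow> real" where
  "P_opt K H N0 PT lam k p P0 =
     (if P_tmp K H N0 lam k p P0 > PT then PT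
      else if 0 < P_tmp K H N0 lam k p P0 then P_tmp K H N0 lam k p P0
      else 0)"

definition pos_part :: "real \<Rightarrow> real" where
  "pos_part x = max x 0"

end

theory Submission
  imports Defs
begin

text \<open>
  The utility is concave, so a point \<open>x\<close> of the feasible interval is optimal as soon as the
  tangent line at \<open>x\<close> is at most its value at \<open>x\<close> on the interval. The slope at \<open>x\<close> has the sign of
  \<open>P_tmp - x\<close>, so this is the variational inequality \<open>(y - x) * (P_tmp - x) \<le> 0\<close>
  characterizing \<open>x\<close> as the projection of \<open>P_tmp\<close> onto the interval.
\<close>

lemma ln_minus_linear_le:
  fixes h I l x y :: real
  assumes "h > 0" "I > 0" "l > 0" "x \<ge> 0" "y \<ge> 0"
    and var_ineq: "(y - x) * (1 / l - I / h - x) \<le> 0"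
  shows "ln (1 + h * y / I) - l * y \<le> ln (1 + h * x / I) - l * x"
proof -
  have pos: "I + h * x > 0" "I + h * y > 0"
    using assms by (simp_all add: add_pos_nonneg)
  have pos1: "1 + h * x / I > 0" "1 + h * y / I > 0"
    using assms by (simp_all add: add_pos_nonneg)
  have "ln (1 + h * y / I) - ln (1 + h * x / I) = ln ((1 + h * y / I) / (1 + h * x / I))"
    using pos1 by (subst ln_div) simp_all
  also have "(1 + h * y / I) / (1 + h * x / I) = (I + h * y) / (I + h * x)"
    using \<open>I > 0\<close> pos by (simp add: divide_simps)
  \<comment> \<open>The tangent bound for \<open>ln\<close> at 1, applied to the ratio of the two
    arguments, is the tangent line at \<open>x\<close>: the ratio equals 1 at
    \<open>y = x\<close>.\<close>
  also have "ln \<dots> \<le> (I + h * y) / (I + h * x) - 1"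
    using pos by (intro ln_le_minus_one) simp
  also have "\<dots> = h * (y - x) / (I + h * x)"
    using pos by (simp add: field_simps)
  also have "\<dots> \<le> l * (y - x)"
  proof -
    \<comment> \<open>Clearing the positive denominator \<open>I + h * x\<close> and pulling out
      \<open>h * l > 0\<close> leaves exactly the left side of \<open>var_ineq\<close>.\<close>
    have "h * (y - x) - l * (y - x) * (I + h * x) = h * l * ((y - x) * (1 / l - I / h - x))"
      using assms by (simp add: field_simps)
    also have "\<dots> \<le> 0"
      using assms by (intro mult_nonneg_nonpos[OF _ var_ineq]) simp
    finally show ?thesis
      using pos by (simp add: pos_divide_le_eq)
  qed
  finally show ?thesis
    by (simp add: algebra_simps)
qed

lemma interference_noise_pos:
  assumes "N0 > 0" "H k 0 \<ge> 0" "P0 \<ge> 0"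
    and "\<And>k'. k' \<in> {1..K} - {k} \<Longrightarrow> H k k' \<ge> 0"
    and "\<And>k'. k' \<in> {1..K} - {k} \<Longrightarrow> p k' \<ge> 0"
  shows "interference_noise K H N0 k p P0 > 0"
proof -
  have "(\<Sum>k'\<in>{1..K} - {k}. H k k' * p k') \<ge> 0"
    using assms by (intro sum_nonneg mult_nonneg_nonneg) auto
  moreover have "H k 0 * P0 \<ge> 0"
    using assms by simp
  ultimately show ?thesis
    using \<open>N0 > 0\<close> by (simp add: interference_noise_def)
qed

lemma P_opt_mem:
  assumes "PT \<ge> 0"
  shows "P_opt K H N0 PT lam k p P0 \<in> {0..PT}"
  using assms by (auto simp: P_opt_def)

text \<open>At an endpoint, \<open>P_tmp\<close> lies outside the open interval on that side or at 0
  itself, so the factors have opposite signs or one vanishes; otherwise the second factor is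
  0.\<close>

lemma P_opt_variational:
  assumes "y \<in> {0..PT}"
  shows "(y - P_opt K H N0 PT lam k p P0) *
           (P_tmp K H N0 lam k p P0 - P_opt K H N0 PT lam k p P0) \<le> 0"
  using assms by (auto simp: P_opt_def mult_le_0_iff)

text \<open>Since \<open>PT - pos_part (PT - z)\<close> is \<open>min z PT\<close>, both sides clip
  \<open>P_tmp\<close> first below at 0, then above at \<open>PT\<close>.\<close>

lemma P_opt_eq_pos_part:
  assumes "PT \<ge> 0"
  shows "P_opt K H N0 PT lam k p P0 = PT - pos_part (PT - pos_part (P_tmp K H N0 lam k p P0))"
  using assms by (auto simp: P_opt_def pos_part_def)

theorem theorem1:
  fixes K k :: nat and H :: "nat \<Rightarrow> nat \<Rightarrow> real" and N0 PT P0 :: real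
    and lam p :: "nat \<Rightarrow> real"
  assumes "K \<ge> 1"
    and "\<And>i j. i \<le> K \<Longrightarrow> j \<le> K \<Longrightarrow> H i j > 0"
    and "N0 > 0" and "PT > 0"
    and "\<And>i. i \<le> K \<Longrightarrow> lam i > 0"
    and "k \<in> {1..K}"
    and "P0 \<in> {0..PT}"
    and "\<And>k'. k' \<in> {1..K} - {k} \<Longrightarrow> p k' \<in> {0..PT}"
  shows "is_arg_max (\<lambda>Pk. utility K H N0 lam k Pk p P0) (\<lambda>Pk. 0 \<le> Pk \<and> Pk \<le> PT)
           (P_opt K H N0 PT lam k p P0)
         \<and> P_opt K H N0 PT lam k p P0 = PT - pos_part (PT - pos_part (P_tmp K H N0 lam k p P0))"
proof -
  have H_pos: "H k j > 0" if "j \<le> K" for j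
    using assms(2,6) that by simp
  have noise: "interference_noise K H N0 k p P0 > 0"
  proof (rule interference_noise_pos)
    show "H k 0 \<ge> 0"
      using H_pos[of 0] by simp
    show "H k k' \<ge> 0" if "k' \<in> {1..K} - {k}" for k'
      using H_pos[of k'] that by simp
    show "p k' \<ge> 0" if "k' \<in> {1..K} - {k}" for k'
      using assms(8)[OF that] by simp
  qed (use assms in auto)
  have gains: "H k k > 0" "lam k > 0"
    using H_pos assms(5,6) by auto
  have mem: "P_opt K H N0 PT lam k p P0 \<in> {0..PT}"
    using \<open>PT > 0\<close> by (intro P_opt_mem) simp
  have "utility K H N0 lam k y p P0 \<le> utility K H N0 lam k (P_opt K H N0 PT lam k p P0) p P0"
    if "0 \<le> y" "y \<le> PT" for y
    unfolding utility_def
    using noise gains mem that P_opt_variational[of y PT K H N0 lam k p P0]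
    by (intro ln_minus_linear_le) (simp_all add: P_tmp_def)
  \<comment> \<open>\<open>is_arg_max\<close> says that no feasible point has strictly larger value;
    over the reals \<open>not_less\<close> turns this into the bound just shown.\<close>
  then show ?thesis
    using mem P_opt_eq_pos_part \<open>PT > 0\<close> by (auto simp: is_arg_max_def not_less)
qed

end
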